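(* Let $s$ be a positive integer and let $q$ be a prime power with $q\ge 2s$. Then there is a linear transform $\phi:\mathbb{F}_q^s\to\mathbb{F}_q^s$ that is simultaneously a $(t,s,q)$-AONT for all $t$ with $1\le t\le s$.
   Context: Let $X$ be a finite set with $|X|=v$ and $1\le t\le s$. A function $\phi:X^s\to X^s$, $(x_1,\dots,x_s)\mapsto(y_1,\dots,y_s)$, is a $(t,s,v)$-AONT ($t$-all-or-nothing transform) if (1) $\phi$ is a bijection, and (2) whenever any $s-t$ of the output values $y_1,\dots,y_s$ are fixed (to arbitrary values), any $t$ of the input values are completely undetermined, i.e. for every $I\subseteq\{1,\dots,s\}$ with $|I|=t$, the tuple $(x_i)_{i\in I}$ takes on every value in $X^t$ (hence each exactly once) as the remaining $t$ outputs vary over $X^t$. A transform with alphabet $X=\mathbb{F}_q$ is linear if each $y_i$ is an $\mathbb{F}_q$-linear function of $x_1,\dots,x_s$. *)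

theory Defs
  imports "HOL-Analysis.Cartesian_Space" "HOL-Library.FuncSet" "HOL-Number_Theory.Prime_Powers"
begin

text \<open>
  The coordinates of tuples are indexed by a finite type \<open>'n\<close> with \<open>CARD('n) = s\<close>, so that
  \<open>vecs X\<close> is the set \<open>X\<^sup>s\<close>.
\<close>

definition vecs :: "'x set \<Rightarrow> ('x ^ 'n) set" where
  "vecs X = {x. \<forall>i. x $ i \<in> X}"

text \<open>
  In the last clause \<open>J\<close> is the set of the \<open>s - t\<close> output positions that are fixed to the
  values \<open>c\<close>. As \<open>\<phi>\<close> is a bijection, letting the other \<open>t\<close> outputs vary freely over \<open>X\<close>
  amounts to letting the input \<open>x\<close> range over all of \<open>X\<^sup>s\<close> subject to these constraints.
\<close>

definition AONT :: "nat \<Rightarrow> nat \<Rightarrow> nat \<Rightarrow> 'x set \<Rightarrow> ('x ^ 'n \<Rightarrow> 'x ^ 'n) \<Rightarrow> bool" where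
  "AONT t s v X \<phi> \<longleftrightarrow>
     finite X \<and> card X = v \<and> CARD('n) = s \<and> 1 \<le> t \<and> t \<le> s \<and>
     bij_betw \<phi> (vecs X) (vecs X) \<and>
     (\<forall>J I :: 'n set. card J = s - t \<longrightarrow> card I = t \<longrightarrow>
        (\<forall>c \<in> J \<rightarrow>\<^sub>E X.
           (\<lambda>x. \<lambda>i\<in>I. x $ i) ` {x \<in> vecs X. \<forall>j\<in>J. \<phi> x $ j = c j} = (I \<rightarrow>\<^sub>E X)))"

definition linear_transform :: "('a::field ^ 'n \<Rightarrow> 'a ^ 'n) \<Rightarrow> bool" where
  "linear_transform \<phi> \<longleftrightarrow> (\<forall>i. Vector_Spaces.linear (*s) (*) (\<lambda>x. \<phi> x $ i))"

end

theory Submission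
  imports Defs "HOL-Computational_Algebra.Polynomial"
begin

text \<open>
  The transform is multiplication by a Cauchy matrix \<open>1 / (a\<^sub>j - b\<^sub>i)\<close> with \<open>2 s\<close> distinct nodes
  \<open>a\<^sub>j\<close>, \<open>b\<^sub>i\<close>. All its square submatrices are nonsingular: a vector in the kernel of one yields,
  after clearing denominators, a polynomial with at least as many roots as it has coefficients.
  Hence \<open>s - t\<close> outputs together with any \<open>t\<close> inputs determine the input vector, and counting
  turns this injectivity into surjectivity.
\<close>

lemma cauchy_kernel_trivial:
  fixes a :: "'j \<Rightarrow> 'a::field" and b u :: "'k \<Rightarrow> 'a"
  assumes fin: "finite J" "finite K"
    and inj: "inj_on a J" "inj_on b K"
    and neq: "\<And>j k. j \<in> J \<Longrightarrow> k \<in> K \<Longrightarrow> a j \<noteq> b k"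
    and card: "card K \<le> card J"
    and zero: "\<And>j. j \<in> J \<Longrightarrow> (\<Sum>k\<in>K. u k / (a j - b k)) = 0"
    and k: "k \<in> K"
  shows "u k = 0"
proof -
  \<comment> \<open>\<open>p\<close> is the numerator of the rational function
    \<open>\<Sum>m\<in>K. u m / (X - b m)\<close> over the common denominator
    \<open>\<Prod>l\<in>K. (X - b l)\<close>.\<close>
  define P where "P m = (\<Prod>l\<in>K - {m}. [:- b l, 1:])" for m
  define p where "p = (\<Sum>m\<in>K. smult (u m) (P m))"
  have deg: "degree p < card K"
  proof -
    have "degree (smult (u m) (P m)) \<le> card K - 1" if "m \<in> K" for m
    proof -
      have "degree (P m) \<le> (\<Sum>l\<in>K - {m}. degree [:- b l, 1:])"
        unfolding P_def using degree_prod_sum_le[of "K - {m}" "\<lambda>l. [:- b l, 1:]"] fin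
        by (simp add: o_def)
      also have "\<dots> = card K - 1"
        using that fin by simp
      finally show ?thesis
        using degree_smult_le le_trans by blast
    qed
    then have "degree p \<le> card K - 1"
      unfolding p_def using fin by (intro degree_sum_le) auto
    \<comment> \<open>Natural subtraction truncates, so the strict bound needs \<open>K\<close>
      nonempty; the element \<open>k\<close> ensures this.\<close>
    moreover have "card K > 0"
      using k fin by (auto simp: card_gt_0_iff)
    ultimately show ?thesis by simp
  qed
  have root: "poly p (a j) = 0" if j: "j \<in> J" for j
  proof -
    have "poly (P m) (a j) = (\<Prod>l\<in>K. a j - b l) / (a j - b m)" if m: "m \<in> K" for m
      using neq[OF j m] fin m by (simp add: P_def poly_prod prod.remove[of K m])
    then have "poly p (a j) = (\<Sum>m\<in>K. (\<Prod>l\<in>K. a j - b l) * (u m / (a j - b m)))"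
      unfolding p_def by (simp add: poly_sum mult.commute)
    also have "\<dots> = 0"
      using zero[OF j] by (simp only: sum_distrib_left[symmetric] mult_zero_right)
    finally show ?thesis .
  qed
  have "p = 0"
  proof (rule ccontr)
    assume "p \<noteq> 0"
    then have "card (a ` J) \<le> card {x. poly p x = 0}"
      using root by (intro card_mono poly_roots_finite) auto
    also have "\<dots> \<le> degree p"
      using \<open>p \<noteq> 0\<close> by (rule card_poly_roots_bound)
    finally show False
      using deg card inj by (simp add: card_image)
  qed
  \<comment> \<open>Evaluation at the node \<open>b k\<close> isolates \<open>u k\<close>: each
    other \<open>P m\<close> has a factor vanishing there, while \<open>P k\<close> does not vanish
    since \<open>b\<close> is injective on \<open>K\<close>.\<close>
  have "poly (P m) (b k) = 0" if "m \<in> K - {k}" for m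
    using that k fin by (auto simp: P_def poly_prod)
  then have "poly p (b k) = u k * poly (P k) (b k)"
    unfolding p_def using k fin by (simp add: poly_sum sum.remove[of K k])
  moreover have "poly (P k) (b k) \<noteq> 0"
    using inj(2) k fin by (auto simp: P_def poly_prod dest: inj_onD)
  ultimately show ?thesis
    using \<open>p = 0\<close> by simp
qed

text \<open>The assumption \<open>nonsing\<close> amounts to nonsingularity of all square
  submatrices, phrased through supports so that no submatrix has to be formed.\<close>

lemma AONT_UNIV_matrix:
  fixes A :: "'a::{field,finite} ^ 'n ^ 'n"
  assumes nonsing: "\<And>(J :: 'n set) x. card {i. x $ i \<noteq> 0} \<le> card J \<Longrightarrow>
      (\<And>j. j \<in> J \<Longrightarrow> (A *v x) $ j = 0) \<Longrightarrow> x = 0"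
    and t: "1 \<le> t" "t \<le> CARD('n)"
  shows "AONT t CARD('n) CARD('a) UNIV ((*v) A)"
proof -
  have inj: "inj ((*v) A)"
  proof (rule injI)
    fix x y assume "A *v x = A *v y"
    \<comment> \<open>With \<open>J = UNIV\<close> the bound on the support holds trivially.\<close>
    then have "x - y = 0"
      by (intro nonsing[of _ UNIV] card_mono) (auto simp: matrix_vector_mult_diff_distrib)
    then show "x = y" by simp
  qed
  then have bij: "bij_betw ((*v) A) (vecs UNIV) (vecs UNIV)"
    by (simp add: vecs_def bij_def finite_UNIV_inj_surj)
  have onto: "\<exists>x. restrict (($) x) I = d \<and> (\<forall>j\<in>J. (A *v x) $ j = c j)"
    if J: "card J = CARD('n) - t" and I: "card I = t"
      and c: "c \<in> J \<rightarrow>\<^sub>E UNIV" and d: "d \<in> I \<rightarrow>\<^sub>E UNIV" for I J :: "'n set" and c d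
  proof -
    \<comment> \<open>\<open>f\<close> records the \<open>t\<close> chosen inputs and the
      \<open>s - t\<close> fixed outputs. Its target \<open>T\<close> is as large as the whole input
      space, so injectivity forces \<open>f\<close> to hit every pair \<open>(d, c)\<close>.\<close>
    define f where "f x = (restrict (($) x) I, restrict (($) (A *v x)) J)" for x
    define T where "T = (I \<rightarrow>\<^sub>E (UNIV::'a set)) \<times> (J \<rightarrow>\<^sub>E (UNIV::'a set))"
    have "inj f"
    proof (rule injI)
      fix x y assume eq: "f x = f y"
      have I_eq: "x $ i = y $ i" if "i \<in> I" for i
        using eq that unfolding f_def by (auto dest!: fun_cong[of _ _ i])
      have J_eq: "(A *v x) $ j = (A *v y) $ j" if "j \<in> J" for j
        using eq that unfolding f_def by (auto dest!: fun_cong[of _ _ j])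
      \<comment> \<open>Agreement on \<open>I\<close> confines the support of \<open>x - y\<close>
        to \<open>- I\<close>, which has exactly as many elements as \<open>J\<close>.\<close>
      have "card {i. (x - y) $ i \<noteq> 0} \<le> card (- I)"
        using I_eq by (intro card_mono) auto
      also have "\<dots> = card J"
        using I J by (simp add: Compl_eq_Diff_UNIV card_Diff_subset)
      finally have "x - y = 0"
        by (rule nonsing) (simp add: matrix_vector_mult_diff_distrib J_eq)
      then show "x = y" by simp
    qed
    moreover have "card T = CARD('a ^ 'n)"
      using I J t by (simp add: T_def card_cartesian_product card_PiE flip: power_add)
    moreover have "finite T" "range f \<subseteq> T"
      by (auto simp: T_def f_def finite_PiE)
    ultimately have "range f = T"
      by (intro card_subset_eq) (simp_all add: card_image)
    moreover have "(d, c) \<in> T"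
      using c d by (simp add: T_def)
    ultimately obtain x where "f x = (d, c)"
      by (metis rangeE)
    then show ?thesis
      by (auto simp: f_def)
  qed
  have "(\<lambda>x. \<lambda>i\<in>I. x $ i) ` {x \<in> vecs UNIV. \<forall>j\<in>J. (A *v x) $ j = c j} = (I \<rightarrow>\<^sub>E UNIV)"
    if J: "card J = CARD('n) - t" and I: "card I = t"
      and c: "c \<in> J \<rightarrow>\<^sub>E UNIV" for I J :: "'n set" and c
  proof (intro equalityI subsetI)
    fix d :: "'n \<Rightarrow> 'a" assume "d \<in> I \<rightarrow>\<^sub>E UNIV"
    then obtain x where "restrict (($) x) I = d" "\<forall>j\<in>J. (A *v x) $ j = c j"
      using onto[OF J I c] by blast
    then show "d \<in> (\<lambda>x. \<lambda>i\<in>I. x $ i) ` {x \<in> vecs UNIV. \<forall>j\<in>J. (A *v x) $ j = c j}"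
      by (auto simp: vecs_def)
  qed auto
  then show ?thesis
    using t bij by (simp add: AONT_def)
qed

lemma linear_transform_matrix: "linear_transform ((*v) A)"
  unfolding linear_transform_def
proof
  fix i
  show "Vector_Spaces.linear (*s) (*) (\<lambda>x. (A *v x) $ i)"
    by unfold_locales
      (simp_all add: matrix_vector_right_distrib vector_scalar_commute algebra_simps)
qed

theorem theorem2p2:
  fixes s q :: nat
  assumes "s > 0"
    and "primepow q"
    and "q \<ge> 2 * s"
    and "CARD('a::{field,finite}) = q"
    and "CARD('n::finite) = s"
  shows "\<exists>\<phi> :: 'a ^ 'n \<Rightarrow> 'a ^ 'n. linear_transform \<phi> \<and>
           (\<forall>t. 1 \<le> t \<and> t \<le> s \<longrightarrow> AONT t s q UNIV \<phi>)"
proof -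
  \<comment> \<open>This is where \<open>q \<ge> 2 * s\<close> enters. One injection from the sum
    type makes both node families injective and mutually disjoint.\<close>
  have "CARD('n + 'n) \<le> CARD('a)"
    using assms by simp
  then obtain f :: "'n + 'n \<Rightarrow> 'a" where f: "inj f"
    using inj_on_iff_card_le[of "UNIV :: ('n + 'n) set" "UNIV :: 'a set"] by auto
  define a b where "a j = f (Inl j)" and "b i = f (Inr i)" for i j
  define A :: "'a ^ 'n ^ 'n" where "A = (\<chi> j i. 1 / (a j - b i))"
  have "x = 0"
    if card: "card {i. x $ i \<noteq> 0} \<le> card J" and zero: "\<And>j. j \<in> J \<Longrightarrow> (A *v x) $ j = 0"
    for J :: "'n set" and x
  proof -
    \<comment> \<open>Discarding the zero terms lets the kernel lemma use only the columns in the
      support of \<open>x\<close>, of which there are at most \<open>card J\<close>.\<close>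
    have "(\<Sum>i | x $ i \<noteq> 0. x $ i / (a j - b i)) = (A *v x) $ j" for j
      by (auto simp: A_def matrix_vector_mult_def intro!: sum.mono_neutral_cong_left)
    with zero have "(\<Sum>i | x $ i \<noteq> 0. x $ i / (a j - b i)) = 0" if "j \<in> J" for j
      using that by simp
    moreover have "inj a" "inj b" "a j \<noteq> b i" for i j
      using f by (auto simp: a_def b_def inj_def)
    ultimately have "x $ i = 0" if "x $ i \<noteq> 0" for i
      using that card
      by (intro cauchy_kernel_trivial[of J "{i. x $ i \<noteq> 0}" a b "($) x"])
        (auto intro: inj_on_subset)
    then show ?thesis
      by (auto simp: vec_eq_iff)
  qed
  then have "AONT t s q UNIV ((*v) A)" if "1 \<le> t" "t \<le> s" for t
    using AONT_UNIV_matrix[of A t, unfolded assms(4,5)] that by blast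
  then show ?thesis
    using linear_transform_matrix by blast
qed

end
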